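(* The Basilica group $G=\langle a,b\rangle\leq\operatorname{Aut}T$, acting on the binary rooted tree $T$, has the $2$-CSP.
   Context: $T$ is the infinite rooted tree in which every vertex has exactly $2$ children, and $\psi:\operatorname{Aut}T\to\operatorname{Aut}T\wr\operatorname{Sym}(2)$ is the natural isomorphism obtained by identifying each subtree rooted at a first-level vertex with $T$; elements are identified with their images under $\psi$. The Basilica group is $G=\langle a,b\rangle$ with $a,b$ defined recursively by $a=(1,b)$ and $b=(1,a)\varepsilon$, where $\varepsilon$ denotes the swap of the two subtrees at the root. For $G\le\operatorname{Aut}T$, $\mathrm{st}_G(n)$ is the subgroup of elements of $G$ fixing every vertex at distance $n$ from the root. $G$ has the $2$-CSP if every $N\unlhd G$ such that $G/N$ is a finite $2$-group contains $\mathrm{st}_G(n)$ for some $n$. *)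

theory Defs
  imports "HOL-Algebra.Algebra"
begin

text \<open>
  Vertices of the binary rooted tree are finite words over \<^typ>\<open>bool\<close>; the root is
  \<^term>\<open>[]\<close>, and the words starting with \<^term>\<open>False\<close> (\<^term>\<open>True\<close>) form the
  first (second) subtree at the root.  The distance of a vertex from the root is its length.
\<close>

type_synonym vertex = "bool list"

definition child :: "vertex \<Rightarrow> vertex \<Rightarrow> bool" where
  "child u v \<longleftrightarrow> (\<exists>x. v = u @ [x])"

definition tree_automorphism :: "(vertex \<Rightarrow> vertex) \<Rightarrow> bool" where
  "tree_automorphism f \<longleftrightarrow>
     bij f \<and> f [] = [] \<and> (\<forall>u v. child (f u) (f v) \<longleftrightarrow> child u v)"

text \<open>
  Automorphisms act on the right, so a product \<open>g h\<close> means: first \<open>g\<close>, then \<open>h\<close>.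
\<close>

definition Aut_T :: "(vertex \<Rightarrow> vertex) monoid" where
  "Aut_T = \<lparr>carrier = {f. tree_automorphism f}, monoid.mult = (\<lambda>g h. h \<circ> g), one = id\<rparr>"

definition st :: "(vertex \<Rightarrow> vertex) set \<Rightarrow> nat \<Rightarrow> (vertex \<Rightarrow> vertex) set" where
  "st G n = {g \<in> G. \<forall>v. length v = n \<longrightarrow> g v = v}"

definition finite_p_group :: "nat \<Rightarrow> ('a, 'b) monoid_scheme \<Rightarrow> bool" where
  "finite_p_group p H \<longleftrightarrow> group H \<and> finite (carrier H) \<and> (\<exists>k. order H = p ^ k)"

definition has_CSP :: "nat \<Rightarrow> (vertex \<Rightarrow> vertex) set \<Rightarrow> bool" where
  "has_CSP p G \<longleftrightarrow>
     (\<forall>N. N \<lhd> (Aut_T\<lparr>carrier := G\<rparr>) \<longrightarrow>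
          finite_p_group p ((Aut_T\<lparr>carrier := G\<rparr>) Mod N) \<longrightarrow>
          (\<exists>n. st G n \<subseteq> N))"

text \<open>
  The inverse of the isomorphism \<open>\<psi>\<close>: \<open>pair g h\<close> is the element \<open>(g, h)\<close> of the base group
  of the wreath product, and \<open>swap\<close> is \<open>\<epsilon>\<close>.
\<close>

fun pair :: "(vertex \<Rightarrow> vertex) \<Rightarrow> (vertex \<Rightarrow> vertex) \<Rightarrow> vertex \<Rightarrow> vertex" where
  "pair g h [] = []"
| "pair g h (False # w) = False # g w"
| "pair g h (True # w) = True # h w"

fun swap :: "vertex \<Rightarrow> vertex" where
  "swap [] = []"
| "swap (x # w) = (\<not> x) # w"

fun basilica_a :: "vertex \<Rightarrow> vertex" and basilica_b :: "vertex \<Rightarrow> vertex" where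
  "basilica_a [] = []"
| "basilica_a (False # w) = False # w"
| "basilica_a (True # w) = True # basilica_b w"
| "basilica_b [] = []"
| "basilica_b (False # w) = True # w"
| "basilica_b (True # w) = False # basilica_a w"

lemma basilica_a_rec: "basilica_a = pair \<one>\<^bsub>Aut_T\<^esub> basilica_b"
proof
  fix v show "basilica_a v = pair \<one>\<^bsub>Aut_T\<^esub> basilica_b v"
    by (cases "(\<one>\<^bsub>Aut_T\<^esub> :: vertex \<Rightarrow> vertex, basilica_b, v)" rule: pair.cases)
      (auto simp: Aut_T_def)
qed

lemma basilica_b_rec: "basilica_b = pair \<one>\<^bsub>Aut_T\<^esub> basilica_a \<otimes>\<^bsub>Aut_T\<^esub> swap"
proof
  fix v show "basilica_b v = (pair \<one>\<^bsub>Aut_T\<^esub> basilica_a \<otimes>\<^bsub>Aut_T\<^esub> swap) v"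
    by (cases "(\<one>\<^bsub>Aut_T\<^esub> :: vertex \<Rightarrow> vertex, basilica_a, v)" rule: pair.cases)
      (auto simp: Aut_T_def)
qed

definition basilica :: "(vertex \<Rightarrow> vertex) set" where
  "basilica = generate Aut_T {basilica_a, basilica_b}"

lemma group_Aut_T: "group Aut_T"
proof (rule groupI)
  fix f assume "f \<in> carrier Aut_T"
  then have f: "bij f" "f [] = []" "\<And>u v. child (f u) (f v) \<longleftrightarrow> child u v"
    by (auto simp: Aut_T_def tree_automorphism_def)
  have s: "f (inv_into UNIV f v) = v" for v
    using f(1) by (simp add: bij_is_surj surj_f_inv_f)
  have "inv_into UNIV f [] = []"
    using f(1,2) by (metis bij_inv_eq_iff)
  moreover have "child (inv_into UNIV f u) (inv_into UNIV f v) \<longleftrightarrow> child u v" for u v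
    using f(3)[of "inv_into UNIV f u" "inv_into UNIV f v"] by (simp add: s)
  ultimately have "inv_into UNIV f \<in> carrier Aut_T"
    using f(1) by (simp add: Aut_T_def tree_automorphism_def bij_imp_bij_inv)
  moreover have "inv_into UNIV f \<otimes>\<^bsub>Aut_T\<^esub> f = \<one>\<^bsub>Aut_T\<^esub>"
    by (auto simp: Aut_T_def s)
  ultimately show "\<exists>g\<in>carrier Aut_T. g \<otimes>\<^bsub>Aut_T\<^esub> f = \<one>\<^bsub>Aut_T\<^esub>" by blast
qed (auto simp: Aut_T_def tree_automorphism_def bij_comp)

lemma child_Cons: "child (x # u) (y # v) \<longleftrightarrow> x = y \<and> child u v"
  by (auto simp: child_def)

lemma child_Nil: "child [] v \<longleftrightarrow> length v = 1" "\<not> child v []"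
  by (auto simp: child_def length_Suc_conv)

lemma length_basilica:
  "length (basilica_a v) = length v" "length (basilica_b v) = length v"
  by (induction v and v rule: basilica_a_basilica_b.induct) auto

lemma inj_basilica_aux:
  "basilica_a u = basilica_a v \<Longrightarrow> u = v" "basilica_b u = basilica_b v \<Longrightarrow> u = v"
proof (induction u and u arbitrary: v and v rule: basilica_a_basilica_b.induct)
  case 1
  then show ?case by (metis basilica_a.simps(1) length_0_conv length_basilica(1))
next
  case (2 w)
  then show ?case by (cases v rule: basilica_a.cases) simp_all
next
  case (3 w)
  from "3.prems" show ?case by (cases v rule: basilica_a.cases) (auto dest: "3.IH")
next
  case 4
  then show ?case by (metis basilica_b.simps(1) length_0_conv length_basilica(2))
next
  case (5 w)
  then show ?case by (cases v rule: basilica_b.cases) simp_all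
next
  case (6 w)
  from "6.prems" show ?case by (cases v rule: basilica_b.cases) (auto dest: "6.IH")
qed

lemma surj_basilica_aux: "(\<exists>u. basilica_a u = v) \<and> (\<exists>u. basilica_b u = v)"
proof (induction v)
  case Nil
  then show ?case by (intro conjI; rule exI[of _ "[]"]; simp)
next
  case (Cons x v)
  then obtain u u' where u: "basilica_a u = v" "basilica_b u' = v" by blast
  have "basilica_a (x # (if x then u' else v)) = x # v"
    using u by (cases x) simp_all
  moreover have "basilica_b ((\<not> x) # (if x then v else u)) = x # v"
    using u by (cases x) simp_all
  ultimately show ?case by blast
qed

lemma child_basilica_aux:
  "child (basilica_a u) (basilica_a v) \<longleftrightarrow> child u v"
  "child (basilica_b u) (basilica_b v) \<longleftrightarrow> child u v"
proof (induction u and u arbitrary: v and v rule: basilica_a_basilica_b.induct)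
  case (2 w)
  show ?case by (cases v rule: basilica_a.cases) (simp_all add: child_Cons child_Nil)
next
  case (3 w)
  show ?case by (cases v rule: basilica_a.cases) (simp_all add: child_Cons child_Nil "3.IH")
next
  case (5 w)
  show ?case by (cases v rule: basilica_b.cases) (simp_all add: child_Cons child_Nil)
next
  case (6 w)
  show ?case by (cases v rule: basilica_b.cases) (simp_all add: child_Cons child_Nil "6.IH")
qed (simp_all add: child_Nil length_basilica)

lemma basilica_generators_in_Aut_T: "{basilica_a, basilica_b} \<subseteq> carrier Aut_T"
proof -
  have "bij basilica_a" "bij basilica_b"
    using inj_basilica_aux surj_basilica_aux unfolding bij_def inj_def surj_def by metis+
  then show ?thesis
    using child_basilica_aux by (simp add: Aut_T_def tree_automorphism_def)
qed

lemma subgroup_basilica: "subgroup basilica Aut_T"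
  unfolding basilica_def
  by (rule group.generate_is_subgroup[OF group_Aut_T basilica_generators_in_Aut_T])

end

theory Submission
  imports Defs
begin

text \<open>
  Let \<open>G\<close> be the Basilica group and \<open>S\<^sub>n = st G n\<close>.  Every nontrivial finite 2-group has a subgroup of
  index 2, which contains all squares; so it suffices that the squares of elements of \<open>S\<^sub>n\<close> generate
  a subgroup containing \<open>S\<^bsub>n+3\<^esub>\<close>.

  Since \<open>S\<^sub>1\<close> consists of all pairs in \<open>G \<times> G\<close> with equal exponents of \<open>a\<close>, the image of \<open>S\<^sub>n\<close> in the
  product of the abelianizations \<open>\<int>\<^sup>2\<close> of the copies of \<open>G\<close> at level \<open>n\<close> is a pure subgroup.  Elements
  of \<open>S\<^bsub>n+2\<^esub>\<close> have even exponents there, so they are squares of elements of \<open>S\<^sub>n\<close> up to the product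
  of the copies of \<open>G'\<close> at level \<open>n\<close>.  Finally, \<open>([a, b], 1) = [b\<^sup>2, (b, 1)]\<close> is a product of squares
  and commutators of elements of \<open>G'\<close> with elements of \<open>G\<close>, hence the copies of \<open>G'\<close> at level \<open>n + 1\<close>
  lie in the subgroup generated by the squares of \<open>S\<^sub>n\<close>.
\<close>

section \<open>Squares and subgroups of index two\<close>

context group
begin

lemma inv_m_cancel:
  assumes "x \<in> carrier G" "y \<in> carrier G"
  shows "inv x \<otimes> (x \<otimes> y) = y" "x \<otimes> (inv x \<otimes> y) = y"
  using assms by (simp_all flip: m_assoc)

lemmas word_simps = m_assoc inv_mult_group inv_m_cancel

text \<open>If \<open>u\<close> is outside \<open>P\<close>, counting shows that \<open>U\<close> is
  the union of \<open>P\<close> and the coset P u. If u u were outside \<open>P\<close> too, the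
  coset P u u would miss \<open>P\<close> and hence lie in P u, so u u = p u with p in
  \<open>P\<close>; cancelling \<open>u\<close> gives the contradiction u = p.\<close>

lemma index_two_square:
  assumes fin: "finite U" and U: "subgroup U G" and P: "subgroup P G" "P \<subseteq> U"
    and card: "card U = 2 * card P" and u: "u \<in> U"
  shows "u \<otimes> u \<in> P"
proof (rule ccontr)
  assume n: "u \<otimes> u \<notin> P"
  have G: "u \<in> carrier G" using u U by (meson subgroup.mem_carrier)
  have uP: "u \<notin> P" using n P(1) by (auto intro: subgroup.m_closed)
  have PG: "p \<in> carrier G" if "p \<in> P" for p using that P(1) by (meson subgroup.mem_carrier)
  let ?A = "(\<lambda>p. p \<otimes> u) ` P" and ?B = "(\<lambda>p. p \<otimes> (u \<otimes> u)) ` P"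
  have AB: "?A \<subseteq> U" "?B \<subseteq> U"
    using u P(2) U by (auto intro!: subgroup.m_closed[OF U])
  have dA: "P \<inter> ?A = {}"
  proof -
    have False if "p \<in> P" "p \<otimes> u \<in> P" for p
    proof -
      have "inv p \<otimes> (p \<otimes> u) \<in> P"
        by (rule subgroup.m_closed[OF P(1) subgroup.m_inv_closed[OF P(1) that(1)] that(2)])
      then show False using uP G PG[OF that(1)] by (simp add: inv_m_cancel)
    qed
    then show ?thesis by auto
  qed
  have dB: "P \<inter> ?B = {}"
  proof -
    have False if "p \<in> P" "p \<otimes> (u \<otimes> u) \<in> P" for p
    proof -
      have "inv p \<otimes> (p \<otimes> (u \<otimes> u)) \<in> P"
        by (rule subgroup.m_closed[OF P(1) subgroup.m_inv_closed[OF P(1) that(1)] that(2)])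
      then show False using n G PG[OF that(1)] by (simp add: inv_m_cancel)
    qed
    then show ?thesis by auto
  qed
  have cA: "card ?A = card P"
    by (rule card_image) (use G PG in \<open>auto simp: inj_on_def\<close>)
  have fP: "finite P" using fin P(2) by (rule rev_finite_subset)
  have "card (P \<union> ?A) = card P + card P"
    using fP dA by (simp add: card_Un_disjoint cA)
  then have "P \<union> ?A = U"
    using card AB(1) P(2) fin by (intro card_subset_eq) auto
  then have "?B \<subseteq> ?A" using AB(2) dB by auto
  moreover have "u \<otimes> u \<in> ?B"
    using subgroup.one_closed[OF P(1)] G by force
  ultimately obtain p where p: "p \<in> P" "u \<otimes> u = p \<otimes> u" by auto
  then have "u = p" using G PG by simp
  then show False using p uP by simp
qed

lemma subgroup_of_index_two:
  assumes U: "subgroup U G" and card: "card U = 2 ^ Suc k"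
  shows "\<exists>P. subgroup P G \<and> card P = 2 ^ k \<and> (\<forall>u\<in>U. u \<otimes> u \<in> P)"
proof -
  let ?U = "G\<lparr>carrier := U\<rparr>"
  have fin: "finite U" using card by (metis card.infinite power_not_zero zero_neq_numeral)
  have gU: "group ?U" using U by (simp add: subgroup_imp_group)
  \<comment> \<open>Sylow's theorem, applied with the order of \<open>U\<close> written as
    \<open>2 ^ k * 2\<close>, gives a subgroup of half the order.\<close>
  obtain P where P: "subgroup P ?U" "card P = 2 ^ k"
    using sylow_thm[of 2 ?U k 2] gU card fin two_is_prime_nat
    by (auto simp: order_def)
  have PG: "subgroup P G" by (rule incl_subgroup[OF U P(1)])
  have "P \<subseteq> U" using subgroup.subset[OF P(1)] by simp
  then show ?thesis
    using index_two_square[OF fin U PG] P(2) PG card by auto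
qed

end

section \<open>Pairs, the swap and the generators inside Aut T\<close>

interpretation T: group Aut_T
  by (rule group_Aut_T)

abbreviation tmult :: "(vertex \<Rightarrow> vertex) \<Rightarrow> (vertex \<Rightarrow> vertex) \<Rightarrow> vertex \<Rightarrow> vertex"
    (infixl \<open>\<star>\<close> 70)
  where "g \<star> h \<equiv> g \<otimes>\<^bsub>Aut_T\<^esub> h"

abbreviation tone :: "vertex \<Rightarrow> vertex" (\<open>\<iota>\<close>)
  where "\<iota> \<equiv> \<one>\<^bsub>Aut_T\<^esub>"

abbreviation tinv :: "(vertex \<Rightarrow> vertex) \<Rightarrow> vertex \<Rightarrow> vertex"
  where "tinv g \<equiv> inv\<^bsub>Aut_T\<^esub> g"

abbreviation tpow :: "(vertex \<Rightarrow> vertex) \<Rightarrow> int \<Rightarrow> vertex \<Rightarrow> vertex" (infixr \<open>\<up>\<close> 75)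
  where "g \<up> k \<equiv> g [^]\<^bsub>Aut_T\<^esub> k"

lemma tmult_apply: "(g \<star> h) v = h (g v)"
  by (simp add: Aut_T_def)

lemma tone_apply: "\<iota> v = v"
  by (simp add: Aut_T_def)

lemma tree_eqI:
  fixes g h :: "vertex \<Rightarrow> vertex"
  assumes "g [] = h []" "\<And>w. g (False # w) = h (False # w)" "\<And>w. g (True # w) = h (True # w)"
  shows "g = h"
proof
  fix v show "g v = h v"
    using assms by (cases v; cases "hd v") auto
qed

lemma pair_mult: "pair g h \<star> pair g' h' = pair (g \<star> g') (h \<star> h')"
  by (rule tree_eqI) (simp_all add: tmult_apply)

lemma pair_one: "pair \<iota> \<iota> = \<iota>"
  by (rule tree_eqI) (simp_all add: tone_apply)

lemma swap_swap: "swap \<star> swap = \<iota>"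
  by (rule tree_eqI) (simp_all add: tmult_apply tone_apply)

lemma swap_pair: "swap \<star> pair g h = pair h g \<star> swap"
  by (rule tree_eqI) (simp_all add: tmult_apply)

lemma carrier_Aut_T: "g \<in> carrier Aut_T \<longleftrightarrow> tree_automorphism g"
  by (simp add: Aut_T_def)

lemma tree_automorphism_length:
  assumes "tree_automorphism g" shows "length (g v) = length v"
proof (induction v rule: rev_induct)
  case Nil
  then show ?case using assms by (simp add: tree_automorphism_def)
next
  case (snoc x v)
  have "child v (v @ [x])" by (auto simp: child_def)
  then have "child (g v) (g (v @ [x]))" using assms by (simp add: tree_automorphism_def)
  then show ?case using snoc by (auto simp: child_def)
qed

lemma pair_carrier:
  assumes "g \<in> carrier Aut_T" "h \<in> carrier Aut_T"
  shows "pair g h \<in> carrier Aut_T"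
proof -
  have gh: "tree_automorphism g" "tree_automorphism h" using assms by (simp_all add: carrier_Aut_T)
  have inv: "pair g h \<star> pair (tinv g) (tinv h) = \<iota>" "pair (tinv g) (tinv h) \<star> pair g h = \<iota>"
    using assms by (simp_all add: pair_mult pair_one)
  have "bij (pair g h)"
    by (rule o_bij[of "pair (tinv g) (tinv h)"]) (use inv in \<open>simp_all add: Aut_T_def id_def\<close>)
  moreover have "child (pair g h u) (pair g h v) \<longleftrightarrow> child u v" for u v
    using gh by (cases u; cases v; cases "hd u"; cases "hd v")
      (auto simp: child_Cons child_Nil tree_automorphism_length, auto simp: tree_automorphism_def)
  ultimately show ?thesis by (simp add: carrier_Aut_T tree_automorphism_def)
qed

lemma swap_carrier: "swap \<in> carrier Aut_T"
proof -
  have "bij swap"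
    by (rule o_bij[of swap]) (use swap_swap in \<open>simp_all add: Aut_T_def id_def\<close>)
  moreover have "child (swap u) (swap v) \<longleftrightarrow> child u v" for u v
    by (cases u; cases v) (auto simp: child_Cons child_Nil)
  ultimately show ?thesis by (simp add: carrier_Aut_T tree_automorphism_def)
qed

lemma pair_inv:
  assumes "g \<in> carrier Aut_T" "h \<in> carrier Aut_T"
  shows "tinv (pair g h) = pair (tinv g) (tinv h)"
  using assms by (intro T.inv_equality) (simp_all add: pair_mult pair_one pair_carrier)

lemma swap_inv: "tinv swap = swap"
  by (intro T.inv_equality swap_carrier swap_swap)

lemma a_carrier [simp]: "basilica_a \<in> carrier Aut_T"
  and b_carrier [simp]: "basilica_b \<in> carrier Aut_T"
  using basilica_generators_in_Aut_T by auto

lemma inv_a_rec: "tinv basilica_a = pair \<iota> (tinv basilica_b)"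
  by (subst basilica_a_rec) (simp add: pair_inv)

lemma inv_b_rec: "tinv basilica_b = pair (tinv basilica_a) \<iota> \<star> swap"
  by (subst basilica_b_rec)
    (simp add: T.inv_mult_group pair_inv pair_carrier swap_carrier swap_inv swap_pair)

section \<open>Exponent sums in the generators\<close>

text \<open>The integers are the exponent sums of a and b in some word for the automorphism. A
  relation is used because one automorphism has many words; \<open>expo_unique\<close> shows that
  the sums depend on the automorphism alone, so they are its image in the abelianization
  Z^2.\<close>

inductive expo :: "(vertex \<Rightarrow> vertex) \<Rightarrow> int \<Rightarrow> int \<Rightarrow> bool" where
  expo_one: "expo \<iota> 0 0"
| expo_a: "expo g i j \<Longrightarrow> expo (g \<star> basilica_a) (i + 1) j"
| expo_inv_a: "expo g i j \<Longrightarrow> expo (g \<star> tinv basilica_a) (i - 1) j"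
| expo_b: "expo g i j \<Longrightarrow> expo (g \<star> basilica_b) i (j + 1)"
| expo_inv_b: "expo g i j \<Longrightarrow> expo (g \<star> tinv basilica_b) i (j - 1)"

lemma expo_carrier: "expo g i j \<Longrightarrow> g \<in> carrier Aut_T"
  by (induction rule: expo.induct) simp_all

lemma expo_mult:
  assumes "expo g i j" "expo h k l"
  shows "expo (g \<star> h) (i + k) (j + l)"
  using assms(2)
proof (induction rule: expo.induct)
  case expo_one
  then show ?case using assms(1) expo_carrier by simp
next
  case (expo_a h k l)
  from expo.expo_a[OF this(2)] show ?case
    using assms(1) expo_a by (simp add: T.m_assoc expo_carrier algebra_simps)
next
  case (expo_inv_a h k l)
  from expo.expo_inv_a[OF this(2)] show ?case
    using assms(1) expo_inv_a by (simp add: T.m_assoc expo_carrier algebra_simps)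
next
  case (expo_b h k l)
  from expo.expo_b[OF this(2)] show ?case
    using assms(1) expo_b by (simp add: T.m_assoc expo_carrier algebra_simps)
next
  case (expo_inv_b h k l)
  from expo.expo_inv_b[OF this(2)] show ?case
    using assms(1) expo_inv_b by (simp add: T.m_assoc expo_carrier algebra_simps)
qed

lemma expo_gen:
  "expo basilica_a 1 0" "expo (tinv basilica_a) (-1) 0"
  "expo basilica_b 0 1" "expo (tinv basilica_b) 0 (-1)"
  using expo_a[OF expo_one] expo_inv_a[OF expo_one] expo_b[OF expo_one] expo_inv_b[OF expo_one]
  by simp_all

lemma expo_eqI: "expo g i j \<Longrightarrow> g = h \<Longrightarrow> i = k \<Longrightarrow> j = l \<Longrightarrow> expo h k l"
  by simp

lemma expo_inv: "expo g i j \<Longrightarrow> expo (tinv g) (- i) (- j)"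
proof (induction rule: expo.induct)
  case expo_one
  then show ?case by (simp add: expo.expo_one)
next
  case (expo_a g i j)
  show ?case
    by (rule expo_eqI[OF expo_mult[OF expo_gen(2) expo_a.IH]])
      (simp_all add: T.inv_mult_group expo_carrier[OF expo_a.hyps])
next
  case (expo_inv_a g i j)
  show ?case
    by (rule expo_eqI[OF expo_mult[OF expo_gen(1) expo_inv_a.IH]])
      (simp_all add: T.inv_mult_group expo_carrier[OF expo_inv_a.hyps])
next
  case (expo_b g i j)
  show ?case
    by (rule expo_eqI[OF expo_mult[OF expo_gen(4) expo_b.IH]])
      (simp_all add: T.inv_mult_group expo_carrier[OF expo_b.hyps])
next
  case (expo_inv_b g i j)
  show ?case
    by (rule expo_eqI[OF expo_mult[OF expo_gen(3) expo_inv_b.IH]])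
      (simp_all add: T.inv_mult_group expo_carrier[OF expo_inv_b.hyps])
qed

lemma expo_int_pow:
  assumes "expo g i j" shows "expo (g \<up> k) (k * i) (k * j)"
proof -
  have nat: "expo (g \<up> int n) (int n * i) (int n * j)" for n
  proof (induction n)
    case 0
    then show ?case by (simp add: expo_one)
  next
    case (Suc n)
    show ?case
      by (rule expo_eqI[OF expo_mult[OF Suc assms]])
        (use assms expo_carrier T.int_pow_mult[of g "int n" 1] in \<open>simp_all add: algebra_simps\<close>)
  qed
  show ?thesis
  proof (cases k)
    case (nonneg n)
    then show ?thesis using nat by simp
  next
    case (neg n)
    then show ?thesis using expo_inv[OF nat[of "Suc n"]] assms
      by (simp only: T.int_pow_neg expo_carrier mult_minus_left)
  qed
qed

lemma basilica_iff_expo: "g \<in> basilica \<longleftrightarrow> (\<exists>i j. expo g i j)"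
proof
  assume "g \<in> basilica"
  then show "\<exists>i j. expo g i j"
    unfolding basilica_def
  proof (induction rule: generate.induct)
    case one
    then show ?case using expo_one by blast
  next
    case (incl h)
    then show ?case using expo_gen by blast
  next
    case (inv h)
    then show ?case using expo_gen by blast
  next
    case (eng h1 h2)
    then show ?case using expo_mult by blast
  qed
next
  assume "\<exists>i j. expo g i j"
  then obtain i j where "expo g i j" by blast
  moreover have "basilica_a \<in> basilica" "basilica_b \<in> basilica"
    by (simp_all add: basilica_def generate.incl)
  ultimately show "g \<in> basilica"
    using subgroup_basilica
    by (induction rule: expo.induct)
      (simp_all add: subgroup.one_closed subgroup.m_closed subgroup.m_inv_closed)
qed

section \<open>First-level sections and uniqueness of the exponents\<close>

lemma inv_gen_apply:
  "tinv basilica_a [] = []"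
  "tinv basilica_a (False # w) = False # w"
  "tinv basilica_a (True # w) = True # tinv basilica_b w"
  "tinv basilica_b [] = []"
  "tinv basilica_b (False # w) = True # tinv basilica_a w"
  "tinv basilica_b (True # w) = False # w"
  by (subst inv_a_rec inv_b_rec, simp add: tmult_apply tone_apply)+

lemma sections_mult:
  "pair g h \<star> basilica_a = pair g (h \<star> basilica_b)"
  "pair g h \<star> basilica_b = pair g (h \<star> basilica_a) \<star> swap"
  "pair g h \<star> tinv basilica_a = pair g (h \<star> tinv basilica_b)"
  "pair g h \<star> tinv basilica_b = pair (g \<star> tinv basilica_a) h \<star> swap"
  "(pair g h \<star> swap) \<star> basilica_a = pair (g \<star> basilica_b) h \<star> swap"
  "(pair g h \<star> swap) \<star> basilica_b = pair (g \<star> basilica_a) h"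
  "(pair g h \<star> swap) \<star> tinv basilica_a = pair (g \<star> tinv basilica_b) h \<star> swap"
  "(pair g h \<star> swap) \<star> tinv basilica_b = pair g (h \<star> tinv basilica_a)"
  by (rule tree_eqI; simp add: tmult_apply inv_gen_apply)+

text \<open>As a = (1, b) and b = (1, a) swap, each letter a leaves a letter b in one section and
  each letter b leaves a letter a, with the same sign, so the two exponents trade places. Each b or
  b^-1 toggles the swap and, together with it, the difference \<open>i1 - i0\<close> between 0 and
  1.\<close>

lemma expo_sections:
  assumes "expo g i j"
  shows "\<exists>g0 g1 i0 i1 j0 j1. expo g0 i0 j0 \<and> expo g1 i1 j1 \<and> i = j0 + j1 \<and> j = i0 + i1 \<and>
    (i1 = i0 \<and> g = pair g0 g1 \<or> i1 = i0 + 1 \<and> g = pair g0 g1 \<star> swap)"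
  (is "\<exists>g0 g1 i0 i1 j0 j1. ?P g i j g0 g1 i0 i1 j0 j1")
  using assms
proof (induction rule: expo.induct)
  case expo_one
  have "?P \<iota> 0 0 \<iota> \<iota> 0 0 0 0" by (simp add: pair_one expo.expo_one)
  then show ?case by blast
next
  case (expo_a g i j)
  then obtain g0 g1 i0 i1 j0 j1 where P: "?P g i j g0 g1 i0 i1 j0 j1" by blast
  then have "?P (g \<star> basilica_a) (i + 1) j g0 (g1 \<star> basilica_b) i0 i1 j0 (j1 + 1) \<or>
    ?P (g \<star> basilica_a) (i + 1) j (g0 \<star> basilica_b) g1 i0 i1 (j0 + 1) j1"
    by (auto simp: expo.expo_b sections_mult)
  then show ?case by blast
next
  case (expo_inv_a g i j)
  then obtain g0 g1 i0 i1 j0 j1 where P: "?P g i j g0 g1 i0 i1 j0 j1" by blast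
  then have "?P (g \<star> tinv basilica_a) (i - 1) j g0 (g1 \<star> tinv basilica_b) i0 i1 j0 (j1 - 1) \<or>
    ?P (g \<star> tinv basilica_a) (i - 1) j (g0 \<star> tinv basilica_b) g1 i0 i1 (j0 - 1) j1"
    by (auto simp: expo.expo_inv_b sections_mult)
  then show ?case by blast
next
  case (expo_b g i j)
  then obtain g0 g1 i0 i1 j0 j1 where P: "?P g i j g0 g1 i0 i1 j0 j1" by blast
  then have "?P (g \<star> basilica_b) i (j + 1) g0 (g1 \<star> basilica_a) i0 (i1 + 1) j0 j1 \<or>
    ?P (g \<star> basilica_b) i (j + 1) (g0 \<star> basilica_a) g1 (i0 + 1) i1 j0 j1"
    by (auto simp: expo.expo_a sections_mult)
  then show ?case by blast
next
  case (expo_inv_b g i j)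
  then obtain g0 g1 i0 i1 j0 j1 where P: "?P g i j g0 g1 i0 i1 j0 j1" by blast
  then have "?P (g \<star> tinv basilica_b) i (j - 1) (g0 \<star> tinv basilica_a) g1 (i0 - 1) i1 j0 j1 \<or>
    ?P (g \<star> tinv basilica_b) i (j - 1) g0 (g1 \<star> tinv basilica_a) i0 (i1 - 1) j0 j1"
    by (auto simp: expo.expo_inv_a sections_mult)
  then show ?case by blast
qed

text \<open>
  Here the first-level sections of an element of the stabilizer have equal exponents
  of \<open>a\<close>, so each level contributes a factor 2 to one of the two exponents.
\<close>

lemma expo_dvd_if_fixes_level:
  assumes "expo g i j" "\<And>v. length v = n \<Longrightarrow> g v = v"
  shows "2 ^ (n div 2) dvd i \<and> 2 ^ (Suc n div 2) dvd j"
  using assms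
proof (induction n arbitrary: g i j)
  case 0
  then show ?case by simp
next
  case (Suc n)
  from expo_sections[OF Suc.prems(1)] obtain g0 g1 i0 i1 j0 j1
    where e: "expo g0 i0 j0" "expo g1 i1 j1" "i = j0 + j1" "j = i0 + i1"
      and *: "i1 = i0 \<and> g = pair g0 g1 \<or> i1 = i0 + 1 \<and> g = pair g0 g1 \<star> swap" by blast
  have "g \<noteq> pair g0 g1 \<star> swap"
  proof
    assume "g = pair g0 g1 \<star> swap"
    then show False using Suc.prems(2)[of "True # replicate n True"] by (simp add: tmult_apply)
  qed
  with * have g: "i1 = i0" "g = pair g0 g1" by auto
  have "g0 v = v" "g1 v = v" if "length v = n" for v
    using Suc.prems(2)[of "False # v"] Suc.prems(2)[of "True # v"] g(2) that by simp_all
  with Suc.IH e(1,2) have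
    "2 ^ (n div 2) dvd i0" "2 ^ (Suc n div 2) dvd j0" "2 ^ (Suc n div 2) dvd j1" by blast+
  then show ?case using e(3,4) g(1) by simp
qed

text \<open>The identity fixes every level, so by \<open>expo_dvd_if_fixes_level\<close> every power
  of 2 divides both exponents.\<close>

lemma expo_one_unique:
  assumes "expo \<iota> i j" shows "i = 0 \<and> j = 0"
proof -
  have d: "2 ^ n dvd i \<and> 2 ^ n dvd j" for n
  proof -
    have "2 ^ n dvd i" "2 ^ (Suc (2 * n) div 2) dvd j"
      using expo_dvd_if_fixes_level[OF assms, of "2 * n"] by (simp_all add: tone_apply)
    then show ?thesis by simp
  qed
  have "x = 0" if "\<And>n. 2 ^ n dvd x" for x :: int
  proof (rule ccontr)
    assume x: "x \<noteq> 0"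
    have "(2 :: int) ^ nat \<bar>x\<bar> \<le> \<bar>x\<bar>"
      using that[of "nat \<bar>x\<bar>"] x by (metis abs_dvd_iff dvd_abs_iff zdvd_imp_le zero_less_abs_iff)
    moreover have "int (nat \<bar>x\<bar>) < int (2 ^ nat \<bar>x\<bar>)"
      by (simp only: of_nat_less_iff less_exp)
    ultimately show False by simp
  qed
  then show ?thesis using d by blast
qed

lemma expo_unique:
  assumes "expo g i j" "expo g k l" shows "i = k \<and> j = l"
proof -
  have "expo (g \<star> tinv g) (i + - k) (j + - l)"
    using assms by (intro expo_mult expo_inv)
  then show ?thesis using expo_one_unique[of "i - k" "j - l"] assms by (simp add: expo_carrier)
qed

section \<open>Which pairs lie in G\<close>

abbreviation pow_a :: "int \<Rightarrow> vertex \<Rightarrow> vertex"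
  where "pow_a i \<equiv> basilica_a \<up> i"

lemma pow_a_add_one: "pow_a (i + 1) = pow_a i \<star> basilica_a"
  and pow_a_diff_one: "pow_a (i - 1) = pow_a i \<star> tinv basilica_a"
  by (simp_all add: T.int_pow_mult T.int_pow_diff)

lemma expo_pow_a: "expo (pow_a i) i 0"
  using expo_int_pow[OF expo_gen(1), of i] by simp

lemma b_square: "basilica_b \<star> basilica_b = pair basilica_a basilica_a"
  by (rule tree_eqI) (simp_all add: tmult_apply)

lemma inv_b_square: "tinv basilica_b \<star> tinv basilica_b = pair (tinv basilica_a) (tinv basilica_a)"
  using arg_cong[OF b_square, of tinv] by (simp add: T.inv_mult_group pair_inv)

lemma pair_one_b: "pair \<iota> basilica_b = basilica_a"
  by (rule basilica_a_rec[symmetric])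

lemma pair_b_one: "pair basilica_b \<iota> = basilica_b \<star> basilica_a \<star> tinv basilica_b"
proof -
  have "pair basilica_b \<iota> \<star> basilica_b = basilica_b \<star> basilica_a"
    by (rule tree_eqI) (simp_all add: tmult_apply tone_apply)
  then show ?thesis
    by (intro T.inv_solve_right[THEN iffD2]) (simp_all add: pair_carrier)
qed

lemma expo_pair_b_one: "expo (pair basilica_b \<iota>) 1 0"
  unfolding pair_b_one
  by (rule expo_eqI[OF expo_mult[OF expo_mult[OF expo_gen(3,1)] expo_gen(4)]]) simp_all

text \<open>In a word for \<open>g\<close>, replace a by (a, a) = b^2, and b by (b, 1) = b a b^-1
  for the first pair or by (1, b) = a for the second. One coordinate reproduces \<open>g\<close> and
  the other collects only powers of a.\<close>

lemma expo_pair_pow_a: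
  assumes "expo g i j"
  shows "expo (pair g (pow_a i)) j (2 * i) \<and> expo (pair (pow_a i) g) j (2 * i)"
  using assms
proof (induction rule: expo.induct)
  case expo_one
  then show ?case by (simp add: pair_one expo.expo_one)
next
  case (expo_a g i j)
  have "expo (pair h k \<star> (basilica_b \<star> basilica_b)) j (2 * (i + 1))" if "expo (pair h k) j (2 * i)" for h k
    by (rule expo_eqI[OF expo_mult[OF that expo_mult[OF expo_gen(3,3)]]]) simp_all
  with expo_a.IH show ?case by (simp add: b_square pair_mult pow_a_add_one)
next
  case (expo_inv_a g i j)
  have "expo (pair h k \<star> (tinv basilica_b \<star> tinv basilica_b)) j (2 * (i - 1))"
    if "expo (pair h k) j (2 * i)" for h k
    by (rule expo_eqI[OF expo_mult[OF that expo_mult[OF expo_gen(4,4)]]]) simp_all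
  with expo_inv_a.IH show ?case by (simp add: inv_b_square pair_mult pow_a_diff_one)
next
  case (expo_b g i j)
  have "expo (pair g (pow_a i) \<star> pair basilica_b \<iota>) (j + 1) (2 * i)"
    using expo_mult[OF conjunct1[OF expo_b.IH] expo_pair_b_one] by simp
  moreover have "expo (pair (pow_a i) g \<star> pair \<iota> basilica_b) (j + 1) (2 * i)"
    using expo_mult[OF conjunct2[OF expo_b.IH] expo_gen(1)] by (simp add: pair_one_b)
  ultimately show ?case by (simp add: pair_mult)
next
  case (expo_inv_b g i j)
  have "expo (pair g (pow_a i) \<star> tinv (pair basilica_b \<iota>)) (j - 1) (2 * i)"
    using expo_mult[OF conjunct1[OF expo_inv_b.IH] expo_inv[OF expo_pair_b_one]] by simp
  moreover have "expo (pair (pow_a i) g \<star> tinv (pair \<iota> basilica_b)) (j - 1) (2 * i)"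
    using expo_mult[OF conjunct2[OF expo_inv_b.IH] expo_gen(2)] by (simp add: pair_one_b)
  ultimately show ?case by (simp add: pair_mult pair_inv)
qed

text \<open>A converse of \<open>expo_sections\<close> in the absence of a swap: (g, h) = (g, a^i)
  (a^i, a^i)^-1 (a^i, h), where all factors come from \<open>expo_pair_pow_a\<close>. The common
  exponent \<open>i\<close> makes the powers of a cancel.\<close>

lemma expo_pair:
  assumes "expo g i k" "expo h i l"
  shows "expo (pair g h) (k + l) (2 * i)"
proof -
  have p: "pair (pow_a (- i)) (pow_a (- i)) = tinv (pair (pow_a i) (pow_a i))"
    by (simp add: pair_inv T.int_pow_neg)
  have "expo (pair (pow_a i) (pow_a i)) 0 (2 * i)"
    using expo_pair_pow_a[OF expo_pow_a] by simp
  then have "expo (pair g (pow_a i) \<star> tinv (pair (pow_a i) (pow_a i)) \<star> pair (pow_a i) h)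
      (k + - 0 + l) (2 * i + - (2 * i) + 2 * i)"
    using expo_pair_pow_a[OF assms(1)] expo_pair_pow_a[OF assms(2)]
    by (intro expo_mult expo_inv) simp_all
  then show ?thesis
    using assms by (simp add: pair_inv pair_mult expo_carrier T.word_simps)
qed


section \<open>Level stabilizers\<close>

lemma st_mult: "g \<in> st basilica n \<Longrightarrow> h \<in> st basilica n \<Longrightarrow> g \<star> h \<in> st basilica n"
  using subgroup.m_closed[OF subgroup_basilica] by (auto simp: st_def tmult_apply)

lemma st_inv: "g \<in> st basilica n \<Longrightarrow> tinv g \<in> st basilica n"
proof -
  assume g: "g \<in> st basilica n"
  then have c: "g \<in> carrier Aut_T"
    using subgroup.mem_carrier[OF subgroup_basilica] by (auto simp: st_def)
  have "tinv g v = v" if "length v = n" for v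
  proof -
    have "tinv g v = (g \<star> tinv g) v" using g that by (simp add: st_def tmult_apply)
    then show ?thesis using c by (simp add: tone_apply)
  qed
  then show ?thesis using g subgroup.m_inv_closed[OF subgroup_basilica] by (simp add: st_def)
qed

lemma one_st: "\<iota> \<in> st basilica n"
  using subgroup.one_closed[OF subgroup_basilica] by (simp add: st_def tone_apply)

lemma st_carrier: "g \<in> st basilica n \<Longrightarrow> g \<in> carrier Aut_T"
  using subgroup.mem_carrier[OF subgroup_basilica] by (auto simp: st_def)

lemma st_pair:
  assumes "expo g i k" "expo h i l" "g \<in> st basilica n" "h \<in> st basilica n"
  shows "pair g h \<in> st basilica (Suc n)"
  using assms expo_pair[OF assms(1,2)]
  by (auto simp: st_def basilica_iff_expo length_Suc_conv) (metis (full_types) pair.simps(2,3))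

lemma st_Suc_cases:
  assumes "s \<in> st basilica (Suc n)"
  obtains g h i k l where "s = pair g h" "expo g i k" "expo h i l"
    "g \<in> st basilica n" "h \<in> st basilica n"
proof -
  obtain i j where "expo s i j" using assms by (auto simp: st_def basilica_iff_expo)
  from expo_sections[OF this] obtain g h i0 i1 j0 j1
    where e: "expo g i0 j0" "expo h i1 j1"
      and *: "i1 = i0 \<and> s = pair g h \<or> i1 = i0 + 1 \<and> s = pair g h \<star> swap" by blast
  \<comment> \<open>A swap at the root would change the first letter of the all-\<open>True\<close>
    vertex at level \<open>Suc n\<close>.\<close>
  have "s \<noteq> pair g h \<star> swap"
  proof
    assume "s = pair g h \<star> swap"
    moreover have "s (True # replicate n True) = True # replicate n True"
      using assms by (simp add: st_def)
    ultimately show False by (simp add: tmult_apply)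
  qed
  with * have s: "i1 = i0" "s = pair g h" by auto
  have "g v = v" "h v = v" if "length v = n" for v
  proof -
    have "s (False # v) = False # v" "s (True # v) = True # v"
      using assms that by (simp_all add: st_def)
    then show "g v = v" "h v = v" using s(2) by simp_all
  qed
  then have "g \<in> st basilica n" "h \<in> st basilica n"
    using e by (auto simp: st_def basilica_iff_expo)
  then show thesis using that e s by blast
qed

section \<open>Square roots modulo copies of the derived subgroup\<close>

text \<open>\<open>expo g 0 0\<close> characterizes the elements \<open>g\<close> of the derived subgroup \<open>G'\<close> of \<open>G\<close>;
  \<open>derived_level n\<close> is a copy of \<open>G'\<close> at each vertex of level \<open>n\<close>.\<close>

primrec derived_level :: "nat \<Rightarrow> (vertex \<Rightarrow> vertex) set" where
  "derived_level 0 = {g. expo g 0 0}"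
| "derived_level (Suc n) = {pair g h | g h. g \<in> derived_level n \<and> h \<in> derived_level n}"

lemma derived_level_expo: "g \<in> derived_level n \<Longrightarrow> expo g 0 0"
proof (induction n arbitrary: g)
  case 0
  then show ?case by simp
next
  case (Suc n)
  then obtain g0 g1 where "g = pair g0 g1" "expo g0 0 0" "expo g1 0 0" by auto
  then show ?case using expo_pair[of g0 0 0 g1 0] by simp
qed

text \<open>At the root both exponents are even, and any element with half the exponents is a square
  root modulo G'. In the induction step the roots of the two sections are paired, which requires
  their exponents of a to agree.\<close>

lemma st_square_mod_derived_level:
  assumes "s \<in> st basilica (n + 2)"
  shows "\<exists>x\<in>st basilica n. \<exists>r\<in>derived_level n. s = r \<star> (x \<star> x)"
  using assms
proof (induction n arbitrary: s)
  case 0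
  then obtain i j where e: "expo s i j" by (auto simp: st_def basilica_iff_expo)
  \<comment> \<open>Level 2 is the first at which both exponents are forced to be even; level 1
    constrains only that of b.\<close>
  have "2 ^ (2 div 2) dvd i \<and> 2 ^ (Suc 2 div 2) dvd j"
    using 0 by (intro expo_dvd_if_fixes_level[OF e]) (simp add: st_def)
  then obtain k l where kl: "i = 2 * k" "j = 2 * l" by (auto elim!: dvdE)
  define x where "x = pow_a k \<star> basilica_b \<up> l"
  have x: "expo x k l"
    unfolding x_def using expo_mult[OF expo_pow_a expo_int_pow[OF expo_gen(3)], of k l] by simp
  have "expo (s \<star> tinv (x \<star> x)) 0 0"
    by (rule expo_eqI[OF expo_mult[OF e expo_inv[OF expo_mult[OF x x]]]]) (simp_all add: kl)
  moreover have "s = (s \<star> tinv (x \<star> x)) \<star> (x \<star> x)"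
    using e x by (simp add: expo_carrier T.word_simps)
  moreover have "x \<in> st basilica 0"
    using x expo_one by (auto simp: st_def basilica_iff_expo carrier_Aut_T tree_automorphism_def dest: expo_carrier)
  ultimately show ?case by auto
next
  case (Suc n)
  from Suc.prems obtain s0 s1 i k0 k1 where s: "s = pair s0 s1" "expo s0 i k0" "expo s1 i k1"
    "s0 \<in> st basilica (n + 2)" "s1 \<in> st basilica (n + 2)"
    by (auto elim: st_Suc_cases)
  from Suc.IH[OF s(4)] Suc.IH[OF s(5)] obtain x0 r0 x1 r1
    where x: "x0 \<in> st basilica n" "r0 \<in> derived_level n" "s0 = r0 \<star> (x0 \<star> x0)"
      "x1 \<in> st basilica n" "r1 \<in> derived_level n" "s1 = r1 \<star> (x1 \<star> x1)" by blast
  obtain i0 j0 i1 j1 where e: "expo x0 i0 j0" "expo x1 i1 j1"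
    using x(1,4) by (auto simp: st_def basilica_iff_expo)
  have "expo s0 (0 + (i0 + i0)) (0 + (j0 + j0))" "expo s1 (0 + (i1 + i1)) (0 + (j1 + j1))"
    unfolding x(3,6) using e x(2,5) by (blast intro: expo_mult derived_level_expo)+
  \<comment> \<open>Both sections have the same exponent \<open>i\<close> of a, and each root has
    half of it.\<close>
  then have "i = i0 + i0" "i = i1 + i1" using s(2,3) expo_unique by fastforce+
  then have "i1 = i0" by simp
  with e x have "pair x0 x1 \<in> st basilica (Suc n)" by (auto intro: st_pair)
  moreover have "pair r0 r1 \<in> derived_level (Suc n)" using x by auto
  moreover have "s = pair r0 r1 \<star> (pair x0 x1 \<star> pair x0 x1)"
    using s x by (simp add: pair_mult)
  ultimately show ?case by blast
qed

section \<open>Squares and commutators of elements of the derived subgroup\<close>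

text \<open>Restricting \<open>d\<close> to G' makes the generators pass to the next level: (d, 1)
  then lies in G, whereas (x, 1) need not for other elements x of the stabilizer.\<close>

inductive_set sq_comm :: "nat \<Rightarrow> (vertex \<Rightarrow> vertex) set" for n where
  sq_comm_one: "\<iota> \<in> sq_comm n"
| sq_comm_square: "expo d 0 0 \<Longrightarrow> d \<in> st basilica n \<Longrightarrow> d \<star> d \<in> sq_comm n"
| sq_comm_commutator: "expo d 0 0 \<Longrightarrow> d \<in> st basilica n \<Longrightarrow> y \<in> st basilica n \<Longrightarrow>
    d \<star> y \<star> tinv d \<star> tinv y \<in> sq_comm n"
| sq_comm_mult: "g \<in> sq_comm n \<Longrightarrow> h \<in> sq_comm n \<Longrightarrow> g \<star> h \<in> sq_comm n"
| sq_comm_inv: "g \<in> sq_comm n \<Longrightarrow> tinv g \<in> sq_comm n"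

lemma sq_comm_carrier: "g \<in> sq_comm n \<Longrightarrow> g \<in> carrier Aut_T"
  by (induction rule: sq_comm.induct) (simp_all add: st_carrier)

text \<open>Every commutator is a product of three squares: [d, y] = (d y)^2 (y^-1 d^-1 y)^2
  (y^-1)^2.\<close>

lemma sq_comm_subset:
  assumes K: "subgroup K Aut_T" "\<And>x. x \<in> st basilica n \<Longrightarrow> x \<star> x \<in> K" and "g \<in> sq_comm n"
  shows "g \<in> K"
  using assms(3)
proof (induction rule: sq_comm.induct)
  case (sq_comm_commutator d y)
  have "(d \<star> y) \<star> (d \<star> y) \<star> ((tinv y \<star> tinv d \<star> y) \<star> (tinv y \<star> tinv d \<star> y)) \<star> (tinv y \<star> tinv y) \<in> K"
    using sq_comm_commutator by (intro subgroup.m_closed[OF K(1)] K(2) st_mult st_inv)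
  also have "(d \<star> y) \<star> (d \<star> y) \<star> ((tinv y \<star> tinv d \<star> y) \<star> (tinv y \<star> tinv d \<star> y)) \<star> (tinv y \<star> tinv y)
      = d \<star> y \<star> tinv d \<star> tinv y"
    using sq_comm_commutator by (simp add: st_carrier T.word_simps)
  finally show ?case .
qed (use K in \<open>auto simp: subgroup.one_closed subgroup.m_closed subgroup.m_inv_closed\<close>)

lemma sq_comm_pair:
  assumes "g \<in> sq_comm n"
  shows "pair g \<iota> \<in> sq_comm (Suc n) \<and> pair \<iota> g \<in> sq_comm (Suc n)"
  using assms
proof (induction rule: sq_comm.induct)
  case sq_comm_one
  then show ?case by (simp add: pair_one sq_comm.sq_comm_one)
next
  case (sq_comm_square d)
  with sq_comm_square one_st[of n] have
    "expo (pair d \<iota>) 0 0" "pair d \<iota> \<in> st basilica (Suc n)"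
    "expo (pair \<iota> d) 0 0" "pair \<iota> d \<in> st basilica (Suc n)"
    using expo_pair[OF sq_comm_square(1) expo_one] expo_pair[OF expo_one sq_comm_square(1)]
    by (auto intro: st_pair expo_one)
  then have "pair d \<iota> \<star> pair d \<iota> \<in> sq_comm (Suc n)" "pair \<iota> d \<star> pair \<iota> d \<in> sq_comm (Suc n)"
    by (auto intro: sq_comm.sq_comm_square)
  then show ?case by (simp add: pair_mult)
next
  case (sq_comm_commutator d y)
  with sq_comm_commutator one_st[of n] have d:
    "expo (pair d \<iota>) 0 0" "pair d \<iota> \<in> st basilica (Suc n)"
    "expo (pair \<iota> d) 0 0" "pair \<iota> d \<in> st basilica (Suc n)"
    using expo_pair[OF sq_comm_commutator(1) expo_one] expo_pair[OF expo_one sq_comm_commutator(1)]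
    by (auto intro: st_pair expo_one)
  obtain i j where "expo y i j"
    using sq_comm_commutator by (auto simp: st_def basilica_iff_expo)
  \<comment> \<open>The second coordinate of (y, y) commutes with 1, so [(d, 1), (y, y)] = ([d, y],
    1); repeating \<open>y\<close> ensures equal exponents of a.\<close>
  then have "pair y y \<in> st basilica (Suc n)"
    using sq_comm_commutator by (auto intro: st_pair)
  with d have
    "pair d \<iota> \<star> pair y y \<star> tinv (pair d \<iota>) \<star> tinv (pair y y) \<in> sq_comm (Suc n)"
    "pair \<iota> d \<star> pair y y \<star> tinv (pair \<iota> d) \<star> tinv (pair y y) \<in> sq_comm (Suc n)"
    by (auto intro: sq_comm.sq_comm_commutator)
  then show ?case using sq_comm_commutator by (simp add: pair_mult pair_inv st_carrier)
next
  case (sq_comm_mult g h)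
  then show ?case
    using sq_comm.sq_comm_mult[of "pair g \<iota>" "Suc n" "pair h \<iota>"]
      sq_comm.sq_comm_mult[of "pair \<iota> g" "Suc n" "pair \<iota> h"] by (simp add: pair_mult)
next
  case (sq_comm_inv g)
  then show ?case
    using sq_comm.sq_comm_inv[of "pair g \<iota>" "Suc n"] sq_comm.sq_comm_inv[of "pair \<iota> g" "Suc n"]
    by (simp add: pair_inv sq_comm_carrier)
qed

lemma sq_comm_pair_pair:
  assumes "g \<in> sq_comm n" "h \<in> sq_comm n"
  shows "pair g h \<in> sq_comm (Suc n)"
proof -
  have "pair g \<iota> \<star> pair \<iota> h \<in> sq_comm (Suc n)"
    using assms sq_comm_pair by (blast intro: sq_comm_mult)
  then show ?thesis using assms by (simp add: pair_mult sq_comm_carrier)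
qed

section \<open>Copies of the derived subgroup inside \<open>sq_comm\<close>\<close>

lemma st_zero: "st basilica 0 = basilica"
  using subgroup.mem_carrier[OF subgroup_basilica]
  by (auto simp: st_def carrier_Aut_T tree_automorphism_def)

lemma expo_st_zero: "expo g i j \<Longrightarrow> g \<in> st basilica 0"
  by (auto simp: st_zero basilica_iff_expo)

text \<open>Conjugation in G preserves exponents, and the stabilizer of level 0 is all of G, so
  generators of \<open>sq_comm 0\<close> are carried to generators.\<close>

lemma sq_comm_zero_conj:
  assumes "g \<in> sq_comm 0" "expo y k l"
  shows "y \<star> g \<star> tinv y \<in> sq_comm 0"
  using assms(1)
proof (induction rule: sq_comm.induct)
  have y: "y \<in> carrier Aut_T" using assms(2) by (rule expo_carrier)
  have conj: "expo (y \<star> z \<star> tinv y) i j" if "expo z i j" for z i j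
    by (rule expo_eqI[OF expo_mult[OF expo_mult[OF assms(2) that] expo_inv[OF assms(2)]]]) simp_all
  {
    case sq_comm_one
    then show ?case using y by (simp add: sq_comm.sq_comm_one)
  next
    case (sq_comm_square d)
    have "(y \<star> d \<star> tinv y) \<star> (y \<star> d \<star> tinv y) \<in> sq_comm 0"
      using conj[OF sq_comm_square(1)] expo_st_zero by (blast intro: sq_comm.sq_comm_square)
    then show ?case using y sq_comm_square by (simp add: T.word_simps st_carrier)
  next
    case (sq_comm_commutator d z)
    obtain i j where "expo z i j"
      using sq_comm_commutator by (auto simp: st_def basilica_iff_expo)
    then have "(y \<star> d \<star> tinv y) \<star> (y \<star> z \<star> tinv y) \<star> tinv (y \<star> d \<star> tinv y) \<star> tinv (y \<star> z \<star> tinv y) \<in> sq_comm 0"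
      using conj[OF sq_comm_commutator(1)] conj expo_st_zero by (blast intro: sq_comm.sq_comm_commutator)
    then show ?case using y sq_comm_commutator by (simp add: T.word_simps st_carrier)
  next
    case (sq_comm_mult g h)
    have "(y \<star> g \<star> tinv y) \<star> (y \<star> h \<star> tinv y) \<in> sq_comm 0"
      using sq_comm_mult.IH by (rule sq_comm.sq_comm_mult)
    then show ?case using y sq_comm_mult by (simp add: T.word_simps sq_comm_carrier)
  next
    case (sq_comm_inv g)
    have "tinv (y \<star> g \<star> tinv y) \<in> sq_comm 0"
      using sq_comm_inv.IH by (rule sq_comm.sq_comm_inv)
    then show ?case using y sq_comm_inv by (simp add: T.word_simps sq_comm_carrier)
  }
qed

text \<open>With \<open>c = [h, k]\<close> one has \<open>[h, k\<^sup>2] = c (k c k\<inverse>) = c\<^sup>2 [c\<inverse>, k]\<close>.\<close>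

lemma sq_comm_zero_commutator_square:
  assumes "expo h i j" "expo k i' j'"
  shows "h \<star> (k \<star> k) \<star> tinv h \<star> tinv (k \<star> k) \<in> sq_comm 0"
proof -
  define c where "c = h \<star> k \<star> tinv h \<star> tinv k"
  have c: "expo c 0 0"
    unfolding c_def
    by (rule expo_eqI[OF expo_mult[OF expo_mult[OF expo_mult[OF assms] expo_inv[OF assms(1)]]
            expo_inv[OF assms(2)]]]) simp_all
  have ic: "expo (tinv c) 0 0" using expo_inv[OF c] by simp
  have "(c \<star> c) \<star> (tinv c \<star> k \<star> tinv (tinv c) \<star> tinv k) \<in> sq_comm 0"
    using c ic assms(2) by (intro sq_comm_mult sq_comm_square sq_comm_commutator expo_st_zero)
  also have "(c \<star> c) \<star> (tinv c \<star> k \<star> tinv (tinv c) \<star> tinv k) = c \<star> (k \<star> c \<star> tinv k)"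
    using expo_carrier[OF c] expo_carrier[OF assms(2)] by (simp add: T.word_simps)
  also have "\<dots> = h \<star> (k \<star> k) \<star> tinv h \<star> tinv (k \<star> k)"
    using expo_carrier[OF assms(1)] expo_carrier[OF assms(2)] by (simp add: c_def T.word_simps)
  finally show ?thesis .
qed

text \<open>
  \<open>(g, a\<^sup>i)\<close> is obtained from \<open>g\<close>, read as a word in \<open>a\<close> and \<open>b\<close>, by the substitution
  \<open>a \<mapsto> (a, a) = b\<^sup>2\<close>, \<open>b \<mapsto> (b, 1)\<close>; modulo \<open>sq_comm 0\<close> every square is central, so it only depends on
  the exponents of \<open>g\<close>.
\<close>

lemma pair_pow_a_mod_sq_comm:
  assumes "expo g i j"
  shows "\<exists>l\<in>sq_comm 0. pair g (pow_a i) =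
    l \<star> ((basilica_b \<star> basilica_b) \<up> i \<star> pair basilica_b \<iota> \<up> j)"
  using assms
proof (induction rule: expo.induct)
  define x where "x = basilica_b \<star> basilica_b"
  define y where "y = pair basilica_b \<iota>"
  have c: "x \<in> carrier Aut_T" "y \<in> carrier Aut_T" by (simp_all add: x_def y_def pair_carrier)
  have ex: "expo x 0 2" using expo_mult[OF expo_gen(3,3)] by (simp add: x_def)
  have ey: "expo (y \<up> k) k 0" for k
    using expo_int_pow[OF expo_pair_b_one, of k] by (simp add: y_def)
  \<comment> \<open>Moving the square \<open>z\<close> to the left of y^j costs the commutator
    [y^j, z], which lies in \<open>sq_comm 0\<close>; its conjugate by x^i is absorbed into
    \<open>l'\<close>.\<close>
  have xy: "\<exists>l'\<in>sq_comm 0. l \<star> (x \<up> i \<star> y \<up> j) \<star> z = l' \<star> ((x \<up> i \<star> z) \<star> y \<up> j)"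
    if l: "l \<in> sq_comm 0" and z: "z = u \<star> u" "expo u m n" for l i j z u m n
  proof -
    have u: "u \<in> carrier Aut_T" using z expo_carrier by blast
    have "y \<up> j \<star> z \<star> tinv (y \<up> j) \<star> tinv z \<in> sq_comm 0"
      unfolding z(1) by (rule sq_comm_zero_commutator_square[OF ey z(2)])
    from sq_comm_mult[OF l sq_comm_zero_conj[OF this expo_int_pow[OF ex, of i]]]
    show ?thesis
      by (rule rev_bexI) (use c l u in \<open>simp add: z(1) T.word_simps sq_comm_carrier\<close>)
  qed
  note defs = x_def[symmetric] y_def[symmetric]
  {
    case expo_one
    show ?case by (auto simp: pair_one intro!: bexI[of _ \<iota>] sq_comm_one)
  next
    case (expo_a g i j)
    then obtain l where l: "l \<in> sq_comm 0" "pair g (pow_a i) = l \<star> (x \<up> i \<star> y \<up> j)"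
      by (auto simp: defs)
    have "pair (g \<star> basilica_a) (pow_a (i + 1)) = pair g (pow_a i) \<star> x"
      by (simp add: x_def b_square pair_mult pow_a_add_one)
    then show ?case
      using xy[OF l(1) x_def expo_gen(3), of i j] l(2) c by (simp add: defs T.int_pow_mult)
  next
    case (expo_inv_a g i j)
    then obtain l where l: "l \<in> sq_comm 0" "pair g (pow_a i) = l \<star> (x \<up> i \<star> y \<up> j)"
      by (auto simp: defs)
    have "pair (g \<star> tinv basilica_a) (pow_a (i - 1)) = pair g (pow_a i) \<star> tinv x"
      by (simp add: x_def T.inv_mult_group inv_b_square pair_mult pow_a_diff_one)
    moreover have "tinv x = tinv basilica_b \<star> tinv basilica_b" by (simp add: x_def T.inv_mult_group)
    ultimately show ?case
      using xy[OF l(1) _ expo_gen(4), of "tinv x" i j] l(2) c by (simp add: defs T.int_pow_diff)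
  next
    case (expo_b g i j)
    then obtain l where l: "l \<in> sq_comm 0" "pair g (pow_a i) = l \<star> (x \<up> i \<star> y \<up> j)"
      by (auto simp: defs)
    have "pair (g \<star> basilica_b) (pow_a i) = pair g (pow_a i) \<star> y"
      by (simp add: y_def pair_mult)
    then show ?case
      unfolding defs using l c
      by (auto intro!: bexI[of _ l] simp: T.int_pow_mult T.word_simps sq_comm_carrier)
  next
    case (expo_inv_b g i j)
    then obtain l where l: "l \<in> sq_comm 0" "pair g (pow_a i) = l \<star> (x \<up> i \<star> y \<up> j)"
      by (auto simp: defs)
    have "pair (g \<star> tinv basilica_b) (pow_a i) = pair g (pow_a i) \<star> tinv y"
      by (simp add: y_def pair_mult pair_inv)
    then show ?case
      unfolding defs using l c
      by (auto intro!: bexI[of _ l] simp: T.int_pow_diff T.word_simps sq_comm_carrier)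
  }
qed

text \<open>With both exponents 0, \<open>pair_pow_a_mod_sq_comm\<close> puts (g, 1) and (h, 1) in
  \<open>sq_comm 0\<close>. The other coordinate is reached by conjugation, as (1, h) = b^-1 (h, 1)
  b.\<close>

lemma derived_pair_sq_comm:
  assumes g: "expo g 0 0" and h: "expo h 0 0"
  shows "pair g h \<in> sq_comm 0"
proof -
  have left: "pair k \<iota> \<in> sq_comm 0" if "expo k 0 0" for k
    using pair_pow_a_mod_sq_comm[OF that] by (auto simp: sq_comm_carrier)
  have "tinv basilica_b \<star> pair h \<iota> \<star> tinv (tinv basilica_b) \<in> sq_comm 0"
    by (rule sq_comm_zero_conj[OF left[OF h] expo_gen(4)])
  also have "tinv basilica_b \<star> pair h \<iota> \<star> tinv (tinv basilica_b) = pair \<iota> h"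
  proof -
    have "pair h \<iota> \<star> basilica_b = basilica_b \<star> pair \<iota> h"
      by (rule tree_eqI) (simp_all add: tmult_apply tone_apply)
    then show ?thesis using h by (simp add: T.m_assoc T.inv_m_cancel pair_carrier expo_carrier)
  qed
  finally have "pair g \<iota> \<star> pair \<iota> h \<in> sq_comm 0" using left[OF g] by (blast intro: sq_comm_mult)
  then show ?thesis using g h by (simp add: pair_mult expo_carrier)
qed

lemma derived_level_Suc_subset: "derived_level (Suc n) \<subseteq> sq_comm n"
proof (induction n)
  case 0
  then show ?case by (auto intro: derived_pair_sq_comm)
next
  case (Suc n)
  show ?case
  proof
    fix g assume "g \<in> derived_level (Suc (Suc n))"
    then obtain g0 g1 where "g = pair g0 g1" "g0 \<in> derived_level (Suc n)" "g1 \<in> derived_level (Suc n)"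
      unfolding derived_level.simps(2)[of "Suc n"] by blast
    then show "g \<in> sq_comm (Suc n)" using Suc.IH by (blast intro: sq_comm_pair_pair)
  qed
qed

section \<open>Descent through finite 2-quotients\<close>

lemma st_antimono: "st basilica (Suc n) \<subseteq> st basilica n"
proof
  fix g assume g: "g \<in> st basilica (Suc n)"
  have "g v = v" if "length v = n" for v
  proof -
    have *: "tree_automorphism g" using st_carrier[OF g] by (simp add: carrier_Aut_T)
    have "child v (v @ [True])" by (auto simp: child_def)
    then have "child (g v) (g (v @ [True]))" using * by (simp add: tree_automorphism_def)
    moreover have "g (v @ [True]) = v @ [True]" using g that by (simp add: st_def)
    ultimately show ?thesis by (simp add: child_def)
  qed
  then show "g \<in> st basilica n" using g by (simp add: st_def)
qed

text \<open>Two of the three levels serve to extract a square root in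
  \<open>st basilica (Suc n)\<close>; the third leaves the remainder in the copies of G' at level
  \<open>Suc n\<close>, which lie in \<open>sq_comm n\<close>.\<close>

lemma st_subset_squares:
  assumes "subgroup K Aut_T" "\<And>x. x \<in> st basilica n \<Longrightarrow> x \<star> x \<in> K"
  shows "st basilica (n + 3) \<subseteq> K"
proof
  fix s assume "s \<in> st basilica (n + 3)"
  then have "s \<in> st basilica (Suc n + 2)" by (simp add: numeral_3_eq_3)
  from st_square_mod_derived_level[OF this] obtain x r where
    x: "x \<in> st basilica (Suc n)" "r \<in> derived_level (Suc n)" "s = r \<star> (x \<star> x)" by blast
  have "r \<in> K" using x(2) derived_level_Suc_subset sq_comm_subset[OF assms] by blast
  moreover have "x \<star> x \<in> K" using x(1) st_antimono assms(2) by blast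
  ultimately show "s \<in> K" using x(3) subgroup.m_closed[OF assms(1)] by simp
qed

text \<open>\<open>U\<close> is a subgroup containing the image of a level stabilizer. Passing to a
  subgroup \<open>P\<close> of index 2 in \<open>U\<close> costs three levels, since the preimage of
  \<open>P\<close> contains all squares from \<open>st basilica n\<close>. After \<open>k\<close>
  halvings the image is trivial.\<close>

lemma hom_to_two_group:
  assumes Q: "group Q" and f: "f \<in> hom (Aut_T\<lparr>carrier := basilica\<rparr>) Q"
  shows "subgroup U Q \<Longrightarrow> card U = 2 ^ k \<Longrightarrow> \<forall>s\<in>st basilica n. f s \<in> U
    \<Longrightarrow> \<exists>m. \<forall>s\<in>st basilica m. f s = \<one>\<^bsub>Q\<^esub>"
proof (induction k arbitrary: U n)
  case 0
  then have "U = {\<one>\<^bsub>Q\<^esub>}" by (auto simp: card_1_singleton_iff dest: subgroup.one_closed)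
  then show ?case using 0 by blast
next
  case (Suc k)
  obtain P where P: "subgroup P Q" "card P = 2 ^ k" "\<forall>u\<in>U. u \<otimes>\<^bsub>Q\<^esub> u \<in> P"
    using group.subgroup_of_index_two[OF Q Suc.prems(1,2)] by blast
  let ?B = "Aut_T\<lparr>carrier := basilica\<rparr>"
  interpret f: group_hom ?B Q f
    using Q f subgroup_basilica
    by (simp add: group_hom_def group_hom_axioms_def T.subgroup_imp_group)
  let ?K = "{g \<in> basilica. f g \<in> P}"
  have inv: "f (tinv g) = inv\<^bsub>Q\<^esub> f g" if "g \<in> basilica" for g
    using f.hom_inv[of g] that T.m_inv_consistent[OF subgroup_basilica that] by simp
  have "subgroup ?K Aut_T"
  proof (rule T.subgroupI)
    show "?K \<subseteq> carrier Aut_T" using subgroup.subset[OF subgroup_basilica] by blast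
    have "\<iota> \<in> ?K"
      using f.hom_one subgroup.one_closed[OF subgroup_basilica] subgroup.one_closed[OF P(1)] by simp
    then show "?K \<noteq> {}" by blast
  next
    fix g assume "g \<in> ?K"
    then show "tinv g \<in> ?K"
      using inv subgroup.m_inv_closed[OF subgroup_basilica] subgroup.m_inv_closed[OF P(1)] by simp
  next
    fix g h assume "g \<in> ?K" "h \<in> ?K"
    then show "g \<star> h \<in> ?K"
      using f.hom_mult[of g h] subgroup.m_closed[OF subgroup_basilica] subgroup.m_closed[OF P(1)] by simp
  qed
  moreover have "x \<star> x \<in> ?K" if "x \<in> st basilica n" for x
    using that f.hom_mult[of x x] subgroup.m_closed[OF subgroup_basilica] P(3) Suc.prems(3)
    by (auto simp: st_def)
  ultimately have "st basilica (n + 3) \<subseteq> ?K" by (rule st_subset_squares)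
  then show ?case using Suc.IH[OF P(1,2)] by blast
qed

theorem mainTheorem5: "has_CSP 2 basilica"
  unfolding has_CSP_def
proof (intro allI impI)
  let ?B = "Aut_T\<lparr>carrier := basilica\<rparr>"
  fix N assume N: "N \<lhd> ?B" and fin: "finite_p_group 2 (?B Mod N)"
  interpret N: normal N ?B by (rule N)
  obtain k where k: "group (?B Mod N)" "card (carrier (?B Mod N)) = 2 ^ k"
    using fin by (auto simp: finite_p_group_def order_def)
  have "\<forall>s\<in>st basilica 0. N #>\<^bsub>?B\<^esub> s \<in> carrier (?B Mod N)"
    using N.r_coset_hom_Mod by (auto simp: hom_def st_def)
  \<comment> \<open>The descent starts at level 0 with \<open>U\<close> the whole quotient; the
    identity of the quotient is the coset \<open>N\<close>.\<close>
  from hom_to_two_group[OF k(1) N.r_coset_hom_Mod group.subgroup_self[OF k(1)] k(2) this]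
  obtain n where n: "\<forall>s\<in>st basilica n. N #>\<^bsub>?B\<^esub> s = N" by (auto simp: FactGroup_def)
  have "st basilica n \<subseteq> N"
  proof
    fix s assume "s \<in> st basilica n"
    then show "s \<in> N"
      using n N.rcos_self[of s] N.subgroup_axioms by (auto simp: st_def)
  qed
  then show "\<exists>n. st basilica n \<subseteq> N" ..
qed

end
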